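(* Fix $d\ge 1$ and let $m(n,d)$ denote the number of maximum classes $\mathcal{F}\subseteq 2^{[n]}$ of VC dimension $d$. Then, as $n\to\infty$, $$m(n,d)=n^{\binom{n}{d}(1-o(1))}.$$ Moreover, the same holds even for the number of intersection-closed maximum classes of VC dimension $d$: the number of intersection-closed maximum classes $\mathcal{F}\subseteq 2^{[n]}$ of VC dimension $d$ is $n^{\binom{n}{d}(1-o(1))}$.
   Context: $[n]=\{1,\dots,n\}$. A family $\mathcal{F}\subseteq 2^{[n]}$ shatters $S\subseteq[n]$ if $\{S\cap F: F\in\mathcal{F}\}=2^S$. The VC dimension of $\mathcal{F}$ is the maximum cardinality of a set shattered by $\mathcal{F}$. By the Perles–Sauer–Shelah bound, a family of VC dimension $d$ has at most $\sum_{i=0}^d\binom{n}{i}$ members; a family $\mathcal{F}\subseteq 2^{[n]}$ of VC dimension $d$ is a maximum class if $|\mathcal{F}|=\sum_{i=0}^{d}\binom{n}{i}$. A family is intersection-closed if $F\cap F'\in\mathcal{F}$ for all $F,F'\in\mathcal{F}$. *)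

theory Defs
  imports Complex_Main "HOL-Library.Landau_Symbols"
begin

definition shatters :: "'a set set \<Rightarrow> 'a set \<Rightarrow> bool" where
  "shatters \<F> S \<longleftrightarrow> {S \<inter> F | F. F \<in> \<F>} = Pow S"

(* For families on the ground set {1..n}.  The set under Max is finite; it is nonempty
   whenever \<F> is nonempty, since then {} is shattered.  The value at \<F> = {} is
   unspecified, which is harmless below: maximum classes are nonempty by their cardinality. *)
definition vc_dim :: "nat \<Rightarrow> nat set set \<Rightarrow> nat" where
  "vc_dim n \<F> = Max {card S | S. S \<subseteq> {1..n} \<and> shatters \<F> S}"

definition maximum_class :: "nat \<Rightarrow> nat \<Rightarrow> nat set set \<Rightarrow> bool" where
  "maximum_class n d \<F> \<longleftrightarrow>
     \<F> \<subseteq> Pow {1..n} \<and> vc_dim n \<F> = d \<and> card \<F> = (\<Sum>i=0..d. n choose i)"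

definition intersection_closed :: "'a set set \<Rightarrow> bool" where
  "intersection_closed \<F> \<longleftrightarrow> (\<forall>F\<in>\<F>. \<forall>F'\<in>\<F>. F \<inter> F' \<in> \<F>)"

definition num_maximum_classes :: "nat \<Rightarrow> nat \<Rightarrow> nat" where
  "num_maximum_classes n d = card {\<F>. maximum_class n d \<F>}"

definition num_intersection_closed_maximum_classes :: "nat \<Rightarrow> nat \<Rightarrow> nat" where
  "num_intersection_closed_maximum_classes n d =
     card {\<F>. maximum_class n d \<F> \<and> intersection_closed \<F>}"

end

theory Submission
  imports Defs "HOL-Library.FuncSet" "HOL-Real_Asymp.Real_Asymp"
begin

text \<open>
  Both counts are squeezed between the same two bounds, whose logarithms are
  \<open>(1 + o(1)) (n choose d) ln n\<close>.

  Upper bound. By Pajor's inequality a family has at most as many members as it shatters sets, so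
  a maximum class of VC dimension \<open>d\<close> shatters exactly the sets of size at most \<open>d\<close> and attains
  equality. Families with equality are connected subgraphs of the hypercube
  (\<open>extremal_flip_connected\<close>). A connected subgraph with \<open>m\<close> vertices is recovered from a
  starting vertex, the \<open>m - 1\<close> directions in which a depth-first search discovers new vertices,
  and a string of \<open>2 m - 1\<close> bits that separates discoveries from backtracking
  (\<open>card_flip_connected_le\<close>). This gives at most \<open>2 ^ n * 4 ^ m * n ^ m\<close> classes with
  \<open>m = (\<Sum>i\<le>d. n choose i)\<close>, which is asymptotic to \<open>n choose d\<close>. It is important that each vertex
  costs only one direction: coding by a closed walk on a spanning tree would square the bound.

  Lower bound. Fix a small set \<open>P\<close> of marked points and start from the family of all sets of size at
  most \<open>d\<close>. To every \<open>d\<close>-set \<open>S\<close> that avoids \<open>P\<close>, add one freely chosen point of \<open>P\<close>. The size does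
  not change, intersections stay in the family, and \<open>S\<close> together with its new point is not
  shattered because every member that contains \<open>S\<close> contains that point as well. This gives
  \<open>card P ^ ((n - card P) choose d)\<close> intersection-closed maximum classes
  (\<open>num_intersection_closed_maximum_classes_ge\<close>). The choice \<open>card P \<approx> n / ln n\<close> makes \<open>card P\<close>
  negligible against \<open>n\<close> and yet \<open>ln (card P)\<close> asymptotic to \<open>ln n\<close>.
\<close>

section \<open>Shattering-extremal families\<close>

definition proj :: "'a \<Rightarrow> 'a set set \<Rightarrow> 'a set set" where
  "proj x \<F> = (\<lambda>A. A - {x}) ` \<F>"

definition link :: "'a \<Rightarrow> 'a set set \<Rightarrow> 'a set set" where
  "link x \<F> = {A. x \<notin> A \<and> A \<in> \<F> \<and> insert x A \<in> \<F>}"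

definition shattered :: "'a set set \<Rightarrow> 'a set set" where
  "shattered \<F> = {S. shatters \<F> S}"

definition extremal :: "'a set set \<Rightarrow> bool" where
  "extremal \<F> \<longleftrightarrow> card \<F> = card (shattered \<F>)"

lemma shatters_iff: "shatters \<F> S \<longleftrightarrow> (\<forall>B\<subseteq>S. \<exists>A\<in>\<F>. S \<inter> A = B)"
proof -
  have "{S \<inter> F | F. F \<in> \<F>} = (\<inter>) S ` \<F>" by (rule Setcompr_eq_image)
  moreover have "(\<inter>) S ` \<F> \<subseteq> Pow S" by (rule image_subsetI) simp
  ultimately have "shatters \<F> S \<longleftrightarrow> Pow S \<subseteq> (\<inter>) S ` \<F>"
    unfolding shatters_def by (metis order_antisym order_refl)
  then show ?thesis by (simp add: subset_iff image_iff Bex_def eq_commute)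
qed

lemma shattered_subset: "\<F> \<subseteq> Pow V \<Longrightarrow> shattered \<F> \<subseteq> Pow V"
  unfolding shattered_def shatters_iff by blast

lemma shatters_proj: "shatters (proj x \<F>) S \<longleftrightarrow> x \<notin> S \<and> shatters \<F> S"
proof (cases "x \<in> S")
  case True
  then show ?thesis unfolding shatters_iff proj_def by blast
next
  case False
  then have "S \<inter> (A - {x}) = S \<inter> A" for A by blast
  then show ?thesis using False unfolding shatters_iff proj_def by simp
qed

lemma shatters_link:
  assumes "shatters (link x \<F>) S"
  shows "x \<notin> S" "shatters \<F> (insert x S)"
proof -
  show x: "x \<notin> S"
    using assms unfolding shatters_iff link_def by blast
  show "shatters \<F> (insert x S)"
    unfolding shatters_iff
  proof (intro allI impI)
    fix B assume B: "B \<subseteq> insert x S"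
    then have "B - {x} \<subseteq> S" by blast
    then obtain A where A: "A \<in> link x \<F>" "S \<inter> A = B - {x}"
      using assms unfolding shatters_iff by blast
    then have "x \<notin> A" "A \<in> \<F>" "insert x A \<in> \<F>" by (auto simp: link_def)
    show "\<exists>A\<in>\<F>. insert x S \<inter> A = B"
    proof (cases "x \<in> B")
      case True
      then have "insert x S \<inter> insert x A = B" using A x by auto
      then show ?thesis using \<open>insert x A \<in> \<F>\<close> by blast
    next
      case False
      then have "insert x S \<inter> A = B" using A x \<open>x \<notin> A\<close> by auto
      then show ?thesis using \<open>A \<in> \<F>\<close> by blast
    qed
  qed
qed

text \<open>
  The fibre of \<open>A - {x}\<close> in \<open>\<F>\<close> has two elements when \<open>A - {x}\<close> lies in the link, and one otherwise.
\<close>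

lemma card_proj_link:
  assumes "finite \<F>"
  shows "card \<F> = card (proj x \<F>) + card (link x \<F>)"
proof -
  define F0 where "F0 = {A \<in> \<F>. x \<notin> A}"
  define F1 where "F1 = {A \<in> \<F>. x \<in> A}"
  define G where "G = (\<lambda>A. A - {x}) ` F1"
  have inj: "inj_on (\<lambda>A. A - {x}) F1"
    by (rule inj_onI) (auto simp: F1_def)
  have fin: "finite F0" "finite F1" "finite G"
    using assms by (auto simp: F0_def F1_def G_def)
  have split: "\<F> = F0 \<union> F1" "F0 \<inter> F1 = {}" by (auto simp: F0_def F1_def)
  then have "card \<F> = card F0 + card F1" using fin by (simp add: card_Un_disjoint)
  also have "card F1 = card G" using inj by (simp add: G_def card_image)
  also have "card F0 + card G = card (F0 \<union> G) + card (F0 \<inter> G)"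
    by (rule card_Un_Int[OF fin(1,3)])
  also have "F0 \<union> G = proj x \<F>"
  proof -
    have "(\<lambda>A. A - {x}) ` F0 = id ` F0" by (rule image_cong) (auto simp: F0_def)
    then have "(\<lambda>A. A - {x}) ` F0 = F0" by simp
    then show ?thesis using split(1) by (simp add: G_def proj_def image_Un)
  qed
  also have "F0 \<inter> G = link x \<F>"
  proof
    show "F0 \<inter> G \<subseteq> link x \<F>"
    proof
      fix A assume A: "A \<in> F0 \<inter> G"
      then obtain B where B: "B \<in> F1" "A = B - {x}" by (auto simp: G_def)
      then have "insert x A = B" by (simp add: F1_def insert_absorb)
      then show "A \<in> link x \<F>" using A B(1) by (simp add: F0_def F1_def link_def)
    qed
    show "link x \<F> \<subseteq> F0 \<inter> G"
    proof
      fix A assume "A \<in> link x \<F>"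
      then have "x \<notin> A" "A \<in> \<F>" "insert x A \<in> F1" by (auto simp: link_def F1_def)
      moreover have "A = insert x A - {x}" using \<open>x \<notin> A\<close> by blast
      ultimately show "A \<in> F0 \<inter> G" unfolding G_def F0_def by blast
    qed
  qed
  finally show ?thesis .
qed

lemma finite_shattered: "finite V \<Longrightarrow> \<F> \<subseteq> Pow V \<Longrightarrow> finite (shattered \<F>)"
  by (meson finite_Pow_iff finite_subset shattered_subset)

lemma inj_on_insert_shattered_link: "inj_on (insert x) (shattered (link x \<F>))"
  by (rule inj_onI) (metis CollectD insert_ident shattered_def shatters_link(1))

text \<open>
  The shattered-set analogue of \<open>card_proj_link\<close>: the projection accounts for shattered sets without
  \<open>x\<close>, the link for some of those with \<open>x\<close>.
\<close>

lemma card_shattered_proj_link: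
  assumes "finite V" "\<F> \<subseteq> Pow V"
  shows "card (shattered (proj x \<F>)) + card (shattered (link x \<F>)) \<le> card (shattered \<F>)"
proof -
  have fin: "finite (shattered \<F>)" using assms by (rule finite_shattered)
  have sub: "shattered (proj x \<F>) \<union> insert x ` shattered (link x \<F>) \<subseteq> shattered \<F>"
    by (auto simp: shattered_def shatters_proj dest: shatters_link)
  have disj: "shattered (proj x \<F>) \<inter> insert x ` shattered (link x \<F>) = {}"
    by (auto simp: shattered_def shatters_proj)
  have "card (shattered (proj x \<F>)) + card (shattered (link x \<F>))
      = card (shattered (proj x \<F>) \<union> insert x ` shattered (link x \<F>))"
    using finite_subset[OF sub fin] disj
    by (simp add: card_Un_disjoint card_image inj_on_insert_shattered_link)
  also have "\<dots> \<le> card (shattered \<F>)" using fin sub by (rule card_mono)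
  finally show ?thesis .
qed

lemma proj_Pow_insert: "\<F> \<subseteq> Pow (insert x V) \<Longrightarrow> proj x \<F> \<subseteq> Pow V"
  unfolding proj_def by blast

lemma link_Pow_insert: "\<F> \<subseteq> Pow (insert x V) \<Longrightarrow> link x \<F> \<subseteq> Pow V"
  unfolding link_def by blast

lemma proj_Pow: "\<F> \<subseteq> Pow V \<Longrightarrow> proj x \<F> \<subseteq> Pow V"
  unfolding proj_def by blast

lemma link_Pow: "\<F> \<subseteq> Pow V \<Longrightarrow> link x \<F> \<subseteq> Pow V"
  unfolding link_def by blast

text \<open>
  Pajor's strengthening of the Perles--Sauer--Shelah bound, by induction on the ground set through
  projection and link.
\<close>

lemma card_le_card_shattered:
  assumes "finite V" "\<F> \<subseteq> Pow V"
  shows "card \<F> \<le> card (shattered \<F>)"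
  using assms
proof (induction V arbitrary: \<F> rule: finite_induct)
  case empty
  then consider "\<F> = {}" | "\<F> = {{}}" by auto
  then show ?case
  proof cases
    case 2
    then have "shattered \<F> = {{}}" by (auto simp: shattered_def shatters_iff)
    then show ?thesis using 2 by simp
  qed simp
next
  case (insert x V)
  have fin: "finite (insert x V)" using insert.hyps by simp
  have "card \<F> = card (proj x \<F>) + card (link x \<F>)"
    using insert.prems fin by (intro card_proj_link) (meson finite_Pow_iff finite_subset)
  also have "\<dots> \<le> card (shattered (proj x \<F>)) + card (shattered (link x \<F>))"
    using insert.IH[OF proj_Pow_insert[OF insert.prems]] insert.IH[OF link_Pow_insert[OF insert.prems]]
    by simp
  also have "\<dots> \<le> card (shattered \<F>)"
    using fin insert.prems by (rule card_shattered_proj_link)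
  finally show ?case .
qed

text \<open>
  Equality for \<open>\<F>\<close> forces equality at every place in the induction step of Pajor's inequality. Hence
  extremality is inherited, and the sets shattered by the link are determined by those that
  \<open>\<F>\<close> shatters.
\<close>

lemma
  assumes "finite V" "\<F> \<subseteq> Pow V" "extremal \<F>"
  shows extremal_proj: "extremal (proj x \<F>)"
    and extremal_link: "extremal (link x \<F>)"
    and shatters_link_iff: "shatters (link x \<F>) S \<longleftrightarrow> x \<notin> S \<and> shatters \<F> (insert x S)"
proof -
  have finF: "finite \<F>" using assms by (meson finite_Pow_iff finite_subset)
  have 1: "card \<F> = card (proj x \<F>) + card (link x \<F>)" using finF by (rule card_proj_link)
  have 2: "card (proj x \<F>) \<le> card (shattered (proj x \<F>))"
    using assms by (intro card_le_card_shattered proj_Pow)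
  have 3: "card (link x \<F>) \<le> card (shattered (link x \<F>))"
    using assms by (intro card_le_card_shattered link_Pow)
  have 4: "card (shattered (proj x \<F>)) + card (shattered (link x \<F>)) \<le> card (shattered \<F>)"
    using assms by (intro card_shattered_proj_link)
  have 5: "card \<F> = card (shattered \<F>)" using assms by (simp add: extremal_def)
  show "extremal (proj x \<F>)" "extremal (link x \<F>)"
    unfolding extremal_def using 1 2 3 4 5 by linarith+
  have fin: "finite (shattered \<F>)" using assms by (intro finite_shattered)
  have "card (shattered \<F>) = card {S \<in> shattered \<F>. x \<notin> S} + card {S \<in> shattered \<F>. x \<in> S}"
    using card_Int_Diff[OF fin, of "{S. x \<notin> S}"] by (simp add: Int_def set_diff_eq)
  moreover have "{S \<in> shattered \<F>. x \<notin> S} = shattered (proj x \<F>)"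
    by (auto simp: shattered_def shatters_proj)
  moreover have "card (shattered \<F>) = card (shattered (proj x \<F>)) + card (shattered (link x \<F>))"
    using 1 2 3 4 5 by linarith
  ultimately have "card (insert x ` shattered (link x \<F>)) = card {S \<in> shattered \<F>. x \<in> S}"
    by (simp add: card_image inj_on_insert_shattered_link)
  moreover have "insert x ` shattered (link x \<F>) \<subseteq> {S \<in> shattered \<F>. x \<in> S}"
    by (auto simp: shattered_def dest: shatters_link)
  ultimately have eq: "insert x ` shattered (link x \<F>) = {S \<in> shattered \<F>. x \<in> S}"
    using fin by (intro card_subset_eq) auto
  show "shatters (link x \<F>) S \<longleftrightarrow> x \<notin> S \<and> shatters \<F> (insert x S)"
  proof
    assume "x \<notin> S \<and> shatters \<F> (insert x S)"
    then have "insert x S \<in> insert x ` shattered (link x \<F>)" "x \<notin> S"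
      unfolding eq by (auto simp: shattered_def)
    then obtain T where "shatters (link x \<F>) T" "insert x S = insert x T" "x \<notin> T"
      by (auto simp: shattered_def dest: shatters_link)
    then show "shatters (link x \<F>) S" using \<open>x \<notin> S\<close> by (metis insert_ident)
  qed (auto dest: shatters_link)
qed

text \<open>
  One inclusion holds for every family. Both sides are extremal, and for both the shattered
  sets are those \<open>S\<close> without \<open>x\<close> and \<open>y\<close> for which \<open>insert y S\<close> is shattered by \<open>\<F>\<close>; so the two sides
  have the same cardinality. The other inclusion says that an edge of the projection in
  direction \<open>y\<close> is the image of an edge of \<open>\<F>\<close>.
\<close>

lemma proj_link_commute:
  assumes "finite V" "\<F> \<subseteq> Pow V" "extremal \<F>" "x \<noteq> y"
  shows "proj x (link y \<F>) = link y (proj x \<F>)"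
proof (rule card_subset_eq)
  have sub: "proj x \<F> \<subseteq> Pow V" "link y \<F> \<subseteq> Pow V"
    using assms by (simp_all add: proj_Pow link_Pow)
  show "finite (link y (proj x \<F>))"
    using link_Pow[OF sub(1)] assms(1) by (meson finite_Pow_iff finite_subset)
  show "proj x (link y \<F>) \<subseteq> link y (proj x \<F>)"
  proof
    fix B assume "B \<in> proj x (link y \<F>)"
    then obtain A where A: "y \<notin> A" "A \<in> \<F>" "insert y A \<in> \<F>" "B = A - {x}"
      by (auto simp: proj_def link_def)
    then have "insert y B = insert y A - {x}" using assms(4) by blast
    then show "B \<in> link y (proj x \<F>)" using A by (auto simp: proj_def link_def)
  qed
  have "card (proj x (link y \<F>)) = card (shattered (proj x (link y \<F>)))"
    using extremal_proj[OF assms(1) sub(2) extremal_link[OF assms(1-3)]]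
    by (simp add: extremal_def)
  also have "shattered (proj x (link y \<F>)) = shattered (link y (proj x \<F>))"
    using shatters_link_iff[OF assms(1-3)]
      shatters_link_iff[OF assms(1) sub(1) extremal_proj[OF assms(1-3)]] assms(4)
    by (auto simp: shattered_def shatters_proj)
  also have "card \<dots> = card (link y (proj x \<F>))"
    using extremal_link[OF assms(1) sub(1) extremal_proj[OF assms(1-3)]]
    by (simp add: extremal_def)
  finally show "card (proj x (link y \<F>)) = card (link y (proj x \<F>))" .
qed

section \<open>Extremal families are connected in the hypercube\<close>

definition flip :: "'a \<Rightarrow> 'a set \<Rightarrow> 'a set" where
  "flip k A = (if k \<in> A then A - {k} else insert k A)"

text \<open>
  Connectivity of the subgraph of the hypercube induced by a family is phrased through cuts:
  a nonempty set of members that no edge leaves must be everything. This form passes directly through the induction on the ground set.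
\<close>

definition flip_closed :: "'a set set \<Rightarrow> 'a set set \<Rightarrow> bool" where
  "flip_closed \<F> \<X> \<longleftrightarrow> (\<forall>A\<in>\<X>. \<forall>k. flip k A \<in> \<F> \<longrightarrow> flip k A \<in> \<X>)"

definition flip_connected :: "'a set set \<Rightarrow> bool" where
  "flip_connected \<F> \<longleftrightarrow> (\<forall>\<X>\<subseteq>\<F>. \<X> \<noteq> {} \<longrightarrow> flip_closed \<F> \<X> \<longrightarrow> \<X> = \<F>)"

text \<open>
  Projecting along \<open>x\<close> has connected fibres (one vertex, or the two ends of an edge), and by
  \<open>proj_link_commute\<close> every edge of the projection lifts to an edge of \<open>\<F>\<close>. So a set of vertices that
  no edge leaves is a union of fibres over a set with the same property in the projection, which is
  connected by induction.
\<close>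

lemma extremal_flip_connected:
  assumes "finite V" "\<F> \<subseteq> Pow V" "extremal \<F>"
  shows "flip_connected \<F>"
  using assms
proof (induction V arbitrary: \<F> rule: finite_induct)
  case empty
  then show ?case unfolding flip_connected_def by auto
next
  case (insert x V)
  have fin: "finite (insert x V)" using insert.hyps by simp
  have conn: "flip_connected (proj x \<F>)"
    using insert.IH[OF proj_Pow_insert[OF insert.prems(1)] extremal_proj[OF fin insert.prems]] .
  show ?case
    unfolding flip_connected_def
  proof (intro allI impI)
    fix \<X> assume X: "\<X> \<subseteq> \<F>" "\<X> \<noteq> {}" "flip_closed \<F> \<X>"
    have fibre: "B \<in> \<X>" if "A \<in> \<X>" "B \<in> \<F>" "B - {x} = A - {x}" for A B
    proof -
      have "B = A \<or> B = flip x A" using that(3) unfolding flip_def by auto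
      then show ?thesis using that X(3) unfolding flip_closed_def by blast
    qed
    have "flip_closed (proj x \<F>) (proj x \<X>)"
      unfolding flip_closed_def
    proof (intro ballI allI impI)
      fix A k assume A: "A \<in> proj x \<X>" and k: "flip k A \<in> proj x \<F>"
      have xA: "x \<notin> A" and AF: "A \<in> proj x \<F>" using A X(1) by (auto simp: proj_def)
      have "x \<notin> flip k A" using k by (auto simp: proj_def)
      then have "k \<noteq> x" using xA by (auto simp: flip_def)
      have "A - {k} \<in> link k (proj x \<F>)"
        using AF k by (cases "k \<in> A") (simp_all add: link_def flip_def insert_absorb)
      then have "A - {k} \<in> proj x (link k \<F>)"
        using proj_link_commute[OF fin insert.prems, of x k] \<open>k \<noteq> x\<close> by simp
      then obtain D where D: "k \<notin> D" "D \<in> \<F>" "insert k D \<in> \<F>" "D - {x} = A - {k}"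
        by (auto simp: proj_def link_def)
      \<comment> \<open>The end over \<open>A\<close> of the lifted edge between \<open>D\<close> and \<open>insert k D\<close>.\<close>
      define E where "E = (if k \<in> A then insert k D else D)"
      have E: "E \<in> \<F>" "flip k E \<in> \<F>" "E - {x} = A"
        using D xA \<open>k \<noteq> x\<close> by (auto simp: E_def flip_def)
      obtain A' where "A' \<in> \<X>" "A = A' - {x}" using A by (auto simp: proj_def)
      then have "E \<in> \<X>" using fibre E by simp
      then have "flip k E \<in> \<X>" using X(3) E(2) by (auto simp: flip_closed_def)
      moreover have "flip k E - {x} = flip k A"
        using E(3) \<open>k \<noteq> x\<close> by (auto simp: flip_def)
      ultimately show "flip k A \<in> proj x \<X>" unfolding proj_def by (metis imageI)
    qed
    moreover have "proj x \<X> \<subseteq> proj x \<F>" "proj x \<X> \<noteq> {}"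
      using X by (auto simp: proj_def)
    ultimately have eq: "proj x \<X> = proj x \<F>"
      using conn by (simp add: flip_connected_def)
    have "\<F> \<subseteq> \<X>"
    proof
      fix B assume B: "B \<in> \<F>"
      then have "B - {x} \<in> proj x \<X>" unfolding eq by (simp add: proj_def)
      then obtain A where "A \<in> \<X>" "B - {x} = A - {x}" by (auto simp: proj_def)
      then show "B \<in> \<X>" using fibre B by blast
    qed
    then show "\<X> = \<F>" using X(1) by blast
  qed
qed

section \<open>Counting connected families\<close>

text \<open>
  The decoder of a depth-first search. The first argument is the stack; \<open>True\<close> discovers the
  neighbour of the top vertex in the next recorded direction and pushes it, \<open>False\<close> pops. The bits and
  the directions are kept in separate lists so that the number of codes is a plain product.
\<close>

fun explore :: "'a set list \<Rightarrow> bool list \<Rightarrow> 'a list \<Rightarrow> 'a set set" where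
  "explore (A # As) (True # bs) (k # ks) = insert (flip k A) (explore (flip k A # A # As) bs ks)"
| "explore (A # As) (False # bs) ks = explore As bs ks"
| "explore _ _ _ = {}"

text \<open>
  In a search whose discovered set is \<open>\<X>\<close>, the vertices that have left the stack have no undiscovered
  neighbours. Every undiscovered vertex costs one push and one pop, every vertex on the stack
  one pop, and the search cannot stop early because \<open>\<F>\<close> is connected.
\<close>

lemma explore_complete:
  assumes "finite V" "\<F> \<subseteq> Pow V" "flip_connected \<F>"
    and "\<X> \<subseteq> \<F>" "\<X> \<noteq> {}" "set As \<subseteq> \<X>"
    and "\<And>A k. A \<in> \<X> - set As \<Longrightarrow> flip k A \<in> \<F> \<Longrightarrow> flip k A \<in> \<X>"
  shows "\<exists>bs ks. length bs = 2 * card (\<F> - \<X>) + length As \<and> length ks = card (\<F> - \<X>)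
           \<and> set ks \<subseteq> V \<and> explore As bs ks = \<F> - \<X>"
  using assms(4-)
proof (induction "2 * card (\<F> - \<X>) + length As" arbitrary: \<X> As rule: less_induct)
  case less
  have finF: "finite \<F>" using assms by (meson finite_Pow_iff finite_subset)
  show ?case
  proof (cases As)
    case Nil
    then have "flip_closed \<F> \<X>" using less.prems by (auto simp: flip_closed_def)
    then have "\<X> = \<F>" using less.prems assms(3) by (auto simp: flip_connected_def)
    then show ?thesis using Nil by auto
  next
    case (Cons A As')
    show ?thesis
    proof (cases "\<exists>k. flip k A \<in> \<F> - \<X>")
      case True
      then obtain k where k: "flip k A \<in> \<F> - \<X>" by blast
      define \<Y> where "\<Y> = insert (flip k A) \<X>"
      have "A \<in> \<F>" using less.prems Cons by auto
      have "k \<in> V"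
      proof (cases "k \<in> A")
        case True
        then show ?thesis using \<open>A \<in> \<F>\<close> assms(2) by blast
      next
        case False
        then have "insert k A \<in> \<F>" using k by (simp add: flip_def)
        then show ?thesis using assms(2) by blast
      qed
      have diff: "\<F> - \<X> = insert (flip k A) (\<F> - \<Y>)" "flip k A \<notin> \<F> - \<Y>"
        using k by (auto simp: \<Y>_def)
      then have card: "card (\<F> - \<X>) = Suc (card (\<F> - \<Y>))" using finF by simp
      have "\<exists>bs ks. length bs = 2 * card (\<F> - \<Y>) + length (flip k A # As)
           \<and> length ks = card (\<F> - \<Y>) \<and> set ks \<subseteq> V \<and> explore (flip k A # As) bs ks = \<F> - \<Y>"
      proof (rule less.hyps)
        show "2 * card (\<F> - \<Y>) + length (flip k A # As) < 2 * card (\<F> - \<X>) + length As"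
          using card by simp
        show "\<Y> \<subseteq> \<F>" "\<Y> \<noteq> {}" "set (flip k A # As) \<subseteq> \<Y>"
          using k less.prems by (auto simp: \<Y>_def)
        show "flip j B \<in> \<Y>" if "B \<in> \<Y> - set (flip k A # As)" "flip j B \<in> \<F>" for B j
          using that less.prems(4)[of B j] by (auto simp: \<Y>_def)
      qed
      then obtain bs ks where w: "length bs = 2 * card (\<F> - \<Y>) + length (flip k A # As)"
        "length ks = card (\<F> - \<Y>)" "set ks \<subseteq> V" "explore (flip k A # As) bs ks = \<F> - \<Y>"
        by blast
      show ?thesis
      proof (intro exI conjI)
        show "length (True # bs) = 2 * card (\<F> - \<X>) + length As" using w card by simp
        show "length (k # ks) = card (\<F> - \<X>)" using w card by simp
        show "set (k # ks) \<subseteq> V" using w \<open>k \<in> V\<close> by simp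
        show "explore As (True # bs) (k # ks) = \<F> - \<X>" using w diff Cons by simp
      qed
    next
      case False
      have "\<exists>bs ks. length bs = 2 * card (\<F> - \<X>) + length As'
           \<and> length ks = card (\<F> - \<X>) \<and> set ks \<subseteq> V \<and> explore As' bs ks = \<F> - \<X>"
      proof (rule less.hyps)
        show "2 * card (\<F> - \<X>) + length As' < 2 * card (\<F> - \<X>) + length As"
          using Cons by simp
        show "\<X> \<subseteq> \<F>" "\<X> \<noteq> {}" "set As' \<subseteq> \<X>" using less.prems Cons by auto
        show "flip j B \<in> \<X>" if "B \<in> \<X> - set As'" "flip j B \<in> \<F>" for B j
          using that False less.prems(4)[of B j] Cons by auto
      qed
      then obtain bs ks where w: "length bs = 2 * card (\<F> - \<X>) + length As'"
        "length ks = card (\<F> - \<X>)" "set ks \<subseteq> V" "explore As' bs ks = \<F> - \<X>" by blast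
      show ?thesis
        by (rule exI[of _ "False # bs"], rule exI[of _ ks]) (use w Cons in auto)
    qed
  qed
qed

lemma card_flip_connected_le:
  assumes "finite V" "m > 0"
  shows "card {\<F>. \<F> \<subseteq> Pow V \<and> flip_connected \<F> \<and> card \<F> = m}
           \<le> 2 ^ card V * (2 ^ (2 * (m - 1) + 1) * card V ^ (m - 1))"
proof -
  define BS where "BS = {bs :: bool list. set bs \<subseteq> UNIV \<and> length bs = 2 * (m - 1) + 1}"
  define KS where "KS = {ks. set ks \<subseteq> V \<and> length ks = m - 1}"
  define decode where "decode = (\<lambda>(A, bs, ks). insert A (explore [A] bs (ks :: 'a list)))"
  have fin: "finite BS" "finite KS"
    using assms(1) by (auto simp only: BS_def KS_def intro!: finite_lists_length_eq finite)
  have "{\<F>. \<F> \<subseteq> Pow V \<and> flip_connected \<F> \<and> card \<F> = m} \<subseteq> decode ` (Pow V \<times> BS \<times> KS)"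
  proof
    fix \<F> assume "\<F> \<in> {\<F>. \<F> \<subseteq> Pow V \<and> flip_connected \<F> \<and> card \<F> = m}"
    then have F: "\<F> \<subseteq> Pow V" "flip_connected \<F>" "card \<F> = m" by auto
    then obtain A where A: "A \<in> \<F>" using assms(2) by fastforce
    have "\<exists>bs ks. length bs = 2 * card (\<F> - {A}) + length [A] \<and> length ks = card (\<F> - {A})
           \<and> set ks \<subseteq> V \<and> explore [A] bs ks = \<F> - {A}"
      by (rule explore_complete[OF assms(1) F(1,2)]) (use A in auto)
    moreover have "card (\<F> - {A}) = m - 1" using A F by simp
    ultimately obtain bs ks where w: "bs \<in> BS" "ks \<in> KS" "explore [A] bs ks = \<F> - {A}"
      by (auto simp: BS_def KS_def)
    have "\<F> = decode (A, bs, ks)" using w A by (auto simp: decode_def)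
    then show "\<F> \<in> decode ` (Pow V \<times> BS \<times> KS)" using w A F by blast
  qed
  then have "card {\<F>. \<F> \<subseteq> Pow V \<and> flip_connected \<F> \<and> card \<F> = m} \<le> card (Pow V \<times> BS \<times> KS)"
    using fin assms(1) by (intro surj_card_le) auto
  also have "\<dots> = 2 ^ card V * (2 ^ (2 * (m - 1) + 1) * card V ^ (m - 1))"
    using assms(1) unfolding BS_def KS_def
    by (simp only: card_cartesian_product card_Pow card_lists_length_eq finite card_UNIV_bool)
  finally show ?thesis .
qed

section \<open>The upper bound\<close>

lemma card_subsets_le:
  assumes "finite V"
  shows "card {S. S \<subseteq> V \<and> card S \<le> d} = (\<Sum>i=0..d. card V choose i)"
proof -
  have "{S. S \<subseteq> V \<and> card S \<le> d} = (\<Union>i\<in>{0..d}. {S. S \<subseteq> V \<and> card S = i})" by auto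
  also have "card \<dots> = (\<Sum>i=0..d. card {S. S \<subseteq> V \<and> card S = i})"
    using assms by (intro card_UN_disjoint) auto
  finally show ?thesis using assms by (simp add: n_subsets)
qed

lemma finite_vc_values: "finite {card S | S. S \<subseteq> {1..n :: nat} \<and> shatters \<F> S}"
  by (rule finite_subset[of _ "card ` Pow {1..n}"]) auto

text \<open>
  The shattered sets have size at most \<open>d\<close>, and there are just \<open>card \<F>\<close> sets of that size. So the bound
  opposite to Pajor's inequality holds.
\<close>

lemma maximum_class_extremal:
  assumes "maximum_class n d \<F>"
  shows "extremal \<F>"
proof -
  have F: "\<F> \<subseteq> Pow {1..n}" "vc_dim n \<F> = d" "card \<F> = (\<Sum>i=0..d. n choose i)"
    using assms by (auto simp: maximum_class_def)
  have "shattered \<F> \<subseteq> {S. S \<subseteq> {1..n} \<and> card S \<le> d}"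
  proof
    fix S assume S: "S \<in> shattered \<F>"
    then have "S \<subseteq> {1..n}" using shattered_subset[OF F(1)] by blast
    moreover have "card S \<le> vc_dim n \<F>"
      unfolding vc_dim_def using S \<open>S \<subseteq> {1..n}\<close>
      by (intro Max_ge finite_vc_values) (auto simp: shattered_def)
    ultimately show "S \<in> {S. S \<subseteq> {1..n} \<and> card S \<le> d}" using F by simp
  qed
  then have "card (shattered \<F>) \<le> card {S. S \<subseteq> {1..n} \<and> card S \<le> d}"
    by (intro card_mono) auto
  then have "card (shattered \<F>) \<le> card \<F>" using F by (simp add: card_subsets_le)
  moreover have "card \<F> \<le> card (shattered \<F>)" using F by (intro card_le_card_shattered) auto
  ultimately show ?thesis by (simp add: extremal_def)
qed

lemma finite_families: "finite {\<F> :: nat set set. \<F> \<subseteq> Pow {1..n} \<and> Q \<F>}"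
  by (rule finite_subset[of _ "Pow (Pow {1..n})"]) auto

lemma num_maximum_classes_le:
  fixes n d :: nat
  assumes "n \<ge> 1"
  defines "m \<equiv> \<Sum>i=0..d. n choose i"
  shows "num_maximum_classes n d \<le> 2 ^ n * (2 ^ (2 * m) * n ^ m)"
proof -
  have m: "m > 0" unfolding m_def by (simp add: sum.atLeast_Suc_atMost)
  have "num_maximum_classes n d
      \<le> card {\<F>. \<F> \<subseteq> Pow {1..n} \<and> flip_connected \<F> \<and> card \<F> = m}"
    unfolding num_maximum_classes_def
  proof (rule card_mono)
    show "{\<F>. maximum_class n d \<F>}
        \<subseteq> {\<F>. \<F> \<subseteq> Pow {1..n} \<and> flip_connected \<F> \<and> card \<F> = m}"
      using extremal_flip_connected[of "{1..n}"] maximum_class_extremal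
      by (auto simp: maximum_class_def m_def)
  qed (rule finite_families)
  also have "\<dots> \<le> 2 ^ n * (2 ^ (2 * (m - 1) + 1) * n ^ (m - 1))"
    using card_flip_connected_le[of "{1..n}" m] m by simp
  also have "\<dots> \<le> 2 ^ n * (2 ^ (2 * m) * n ^ m)"
    using m assms(1) by (intro mult_le_mono power_increasing) auto
  finally show ?thesis .
qed

section \<open>Many intersection-closed maximum classes\<close>

locale marked_ground_set =
  fixes V P :: "'a set" and d :: nat
  assumes fin: "finite V" and PV: "P \<subseteq> V"
begin

definition avoiding :: "'a set set" where
  "avoiding = {S. S \<subseteq> V - P \<and> card S = d}"

text \<open>
  The points of \<open>P\<close> serve as labels: the function \<open>p\<close> chooses one for each \<open>d\<close>-set disjoint from \<open>P\<close>.
\<close>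

definition lift :: "('a set \<Rightarrow> 'a) \<Rightarrow> 'a set \<Rightarrow> 'a set" where
  "lift p T = (if T \<in> avoiding then insert (p T) T else T)"

definition lifted :: "('a set \<Rightarrow> 'a) \<Rightarrow> 'a set set" where
  "lifted p = lift p ` {T. T \<subseteq> V \<and> card T \<le> d}"

lemma finite_sub: "T \<subseteq> V \<Longrightarrow> finite T"
  using fin finite_subset by blast

context
  fixes p assumes p: "p \<in> avoiding \<rightarrow> P"
begin

lemma avoiding_subset_lift:
  assumes "S \<in> avoiding" "T \<subseteq> V" "card T \<le> d" "S \<subseteq> lift p T"
  shows "T = S"
proof -
  have S: "S \<inter> P = {}" "card S = d" using assms(1) by (auto simp: avoiding_def)
  have "S \<subseteq> T"
  proof (cases "T \<in> avoiding")
    case True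
    then have "p T \<in> P" using p by blast
    then show ?thesis using assms(4) S(1) True by (auto simp: lift_def)
  qed (use assms(4) in \<open>simp add: lift_def\<close>)
  then have "S = T" using finite_sub[OF assms(2)] assms(3) S(2) by (intro card_seteq) simp_all
  then show ?thesis by simp
qed

text \<open>
  The only member above an avoiding set \<open>S\<close> is its own lift. Therefore the family determines \<open>p\<close>, and
  it does not shatter any set of size \<open>d + 1\<close>.
\<close>

lemma avoiding_subset_lifted:
  assumes "S \<in> avoiding" "A \<in> lifted p" "S \<subseteq> A"
  shows "A = insert (p S) S"
proof -
  obtain T where T: "T \<subseteq> V" "card T \<le> d" "A = lift p T" using assms(2) by (auto simp: lifted_def)
  then have "T = S" using avoiding_subset_lift assms by blast
  then show ?thesis using T assms(1) by (simp add: lift_def)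
qed

lemma lifted_subset: "lifted p \<subseteq> Pow V"
  using p PV by (auto simp: lifted_def lift_def Pi_def split: if_splits)

lemma card_lifted: "card (lifted p) = (\<Sum>i=0..d. card V choose i)"
proof -
  have "inj_on (lift p) {T. T \<subseteq> V \<and> card T \<le> d}"
  proof (rule inj_onI)
    fix S T assume S: "S \<in> {T. T \<subseteq> V \<and> card T \<le> d}" and T: "T \<in> {T. T \<subseteq> V \<and> card T \<le> d}"
      and eq: "lift p S = lift p T"
    consider "S \<in> avoiding" | "T \<in> avoiding" | "S \<notin> avoiding" "T \<notin> avoiding" by blast
    then show "S = T"
    proof cases
      case 1
      then have "S \<subseteq> lift p T" using eq by (auto simp: lift_def)
      then show ?thesis using avoiding_subset_lift 1 T by blast
    next
      case 2
      then have "T \<subseteq> lift p S" using eq by (auto simp: lift_def)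
      then show ?thesis using avoiding_subset_lift 2 S by blast
    next
      case 3
      then show ?thesis using eq by (simp add: lift_def)
    qed
  qed
  then show ?thesis using fin by (simp add: lifted_def card_image card_subsets_le)
qed

lemma unlifted_mem: "T \<subseteq> V \<Longrightarrow> card T \<le> d \<Longrightarrow> T \<notin> avoiding \<Longrightarrow> T \<in> lifted p"
  unfolding lifted_def lift_def by (rule image_eqI[of _ _ T]) auto

text \<open>
  A set that is not avoiding is its own lift, and so are its proper subsets, as they have fewer than
  \<open>d\<close> elements. Two lifts of distinct avoiding sets \<open>S\<close> and \<open>T\<close> meet in \<open>S \<inter> T\<close>, which has fewer than \<open>d\<close>
  elements, and possibly a common label; if the label makes the size \<open>d\<close>, the set meets \<open>P\<close>.
\<close>

lemma intersection_closed_lifted: "intersection_closed (lifted p)"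
proof -
  have aux: "T \<inter> A \<in> lifted p" if T: "T \<subseteq> V" "card T \<le> d" "T \<notin> avoiding" for T A
  proof (cases "T \<inter> A = T")
    case True
    then show ?thesis using that unlifted_mem by simp
  next
    case False
    then have "card (T \<inter> A) < card T" using finite_sub[OF T(1)] by (intro psubset_card_mono) auto
    then show ?thesis using T by (intro unlifted_mem) (auto simp: avoiding_def)
  qed
  have "lift p S \<inter> lift p T \<in> lifted p"
    if S: "S \<subseteq> V" "card S \<le> d" and T: "T \<subseteq> V" "card T \<le> d" for S T
  proof -
    consider "S \<notin> avoiding" | "T \<notin> avoiding" | "S = T" | "S \<in> avoiding" "T \<in> avoiding" "S \<noteq> T"
      by blast
    then show ?thesis
    proof cases
      case 1
      then show ?thesis using aux[OF S] by (simp add: lift_def)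
    next
      case 2
      then show ?thesis using aux[OF T, of "lift p S"] by (simp add: lift_def Int_commute)
    next
      case 3
      then show ?thesis using S by (auto simp: lifted_def)
    next
      case 4
      define I where "I = lift p S \<inter> lift p T"
      have pS: "p S \<in> P" "S \<inter> P = {}" and pT: "p T \<in> P" "T \<inter> P = {}"
        using 4 p by (auto simp: avoiding_def)
      have IV: "I \<subseteq> V" using S T pS PV by (auto simp: I_def lift_def)
      have "S \<inter> T \<noteq> S"
      proof
        assume "S \<inter> T = S"
        then have "S \<subseteq> T" by blast
        then show False using 4 finite_sub[OF T(1)] by (auto simp: avoiding_def card_subset_eq)
      qed
      then have "card (S \<inter> T) < d"
        using 4(1) finite_sub[OF S(1)] psubset_card_mono[of S "S \<inter> T"] by (auto simp: avoiding_def)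
      moreover have sub: "I \<subseteq> insert (p S) (S \<inter> T)" "I - P \<subseteq> S \<inter> T"
        using 4 pS pT by (auto simp: I_def lift_def)
      moreover have "finite (S \<inter> T)" using finite_sub[OF S(1)] by simp
      ultimately have "card I \<le> d" "card (I - P) < d"
        using card_mono[OF _ sub(1)] card_mono[OF _ sub(2)] card_insert_le_m1[of d "S \<inter> T" "p S"]
        by (auto simp: card_insert_if split: if_splits)
      moreover have "I \<notin> avoiding"
      proof
        assume I: "I \<in> avoiding"
        then have "I - P = I" by (auto simp: avoiding_def)
        then show False using I \<open>card (I - P) < d\<close> by (simp add: avoiding_def)
      qed
      ultimately show ?thesis using unlifted_mem IV unfolding I_def[symmetric] by blast
    qed
  qed
  then show ?thesis unfolding intersection_closed_def lifted_def by blast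
qed

text \<open>
  Only a set of the form \<open>insert (p T) T\<close> is large enough to be a counterexample, and the
  trace \<open>T\<close> cannot be cut out of it.
\<close>

lemma card_shattered_lifted_le:
  assumes "shatters (lifted p) U"
  shows "card U \<le> d"
proof (rule ccontr)
  assume U: "\<not> card U \<le> d"
  obtain A where "A \<in> lifted p" "U \<inter> A = U"
    using assms[unfolded shatters_iff, rule_format, of U] by auto
  then have "A \<in> lifted p" "U \<subseteq> A" by blast+
  then obtain T where T: "T \<subseteq> V" "card T \<le> d" "U \<subseteq> lift p T" by (auto simp: lifted_def)
  have TA: "T \<in> avoiding"
  proof (rule ccontr)
    assume "T \<notin> avoiding"
    then have "U \<subseteq> T" using T(3) by (simp add: lift_def)
    then have "card U \<le> card T" by (intro card_mono finite_sub T(1))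
    then show False using T(2) U by simp
  qed
  then have UT: "U \<subseteq> insert (p T) T" using T by (simp add: lift_def)
  have "p T \<in> P" using p TA by blast
  then have pT: "p T \<notin> T" "card T = d" using TA by (auto simp: avoiding_def)
  have eq: "U = insert (p T) T"
    using UT U pT finite_sub[OF T(1)] by (intro card_seteq) auto
  then obtain B where "B \<in> lifted p" "U \<inter> B = T"
    using assms[unfolded shatters_iff, rule_format, of T] by auto
  then show False using avoiding_subset_lifted[OF TA, of B] eq pT by auto
qed

lemma shatters_lifted:
  assumes "U \<subseteq> V" "card U = d" "U \<inter> P \<noteq> {}"
  shows "shatters (lifted p) U"
  unfolding shatters_iff
proof (intro allI impI)
  fix B assume B: "B \<subseteq> U"
  have "B \<in> lifted p"
  proof (rule unlifted_mem)
    show "B \<subseteq> V" using B assms by blast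
    show "card B \<le> d" using B assms finite_sub card_mono by metis
    show "B \<notin> avoiding"
    proof
      assume "B \<in> avoiding"
      then have "card B = card U" using assms(2) by (simp add: avoiding_def)
      then have "B = U" using B finite_sub[OF assms(1)] by (intro card_subset_eq)
      then show False using \<open>B \<in> avoiding\<close> assms(3) by (auto simp: avoiding_def)
    qed
  qed
  then show "\<exists>A\<in>lifted p. U \<inter> A = B" using B by blast
qed

end

lemma inj_on_lifted: "inj_on lifted (avoiding \<rightarrow>\<^sub>E P)"
proof (rule inj_onI)
  fix p q assume p: "p \<in> avoiding \<rightarrow>\<^sub>E P" and q: "q \<in> avoiding \<rightarrow>\<^sub>E P"
    and eq: "lifted p = lifted q"
  show "p = q"
  proof (rule PiE_ext[OF p q])
    fix S assume S: "S \<in> avoiding"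
    then have S': "S \<subseteq> V" "card S \<le> d" "S \<inter> P = {}" by (auto simp: avoiding_def)
    have "insert (p S) S \<in> lifted q"
      unfolding eq[symmetric] unfolding lifted_def
      by (rule image_eqI[of _ _ S]) (use S S' in \<open>auto simp: lift_def\<close>)
    then have "insert (p S) S = insert (q S) S"
      using q S by (intro avoiding_subset_lifted) auto
    moreover have "p S \<in> P" "q S \<in> P" using p q S by auto
    then have "p S \<notin> S" "q S \<notin> S" using S'(3) by auto
    ultimately show "p S = q S" by blast
  qed
qed

end

lemma num_intersection_closed_maximum_classes_ge:
  assumes "1 \<le> k" "k \<le> n" "1 \<le> d" "d \<le> n"
  shows "k ^ ((n - k) choose d) \<le> num_intersection_closed_maximum_classes n d"
proof -
  interpret marked_ground_set "{1..n}" "{1..k}" d by standard (use assms in auto)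
  have "maximum_class n d (lifted p)" "intersection_closed (lifted p)"
    if "p \<in> avoiding \<rightarrow>\<^sub>E {1..k}" for p
  proof -
    have p: "p \<in> avoiding \<rightarrow> {1..k}" using that by auto
    show "intersection_closed (lifted p)" using p by (rule intersection_closed_lifted)
    have sh: "shatters (lifted p) {1..d}" using assms by (intro shatters_lifted[OF p]) auto
    have "vc_dim n (lifted p) = d"
      unfolding vc_dim_def
    proof (rule Max_eqI[OF finite_vc_values])
      show "d \<in> {card S | S. S \<subseteq> {1..n} \<and> shatters (lifted p) S}"
        by (rule CollectI, rule exI[of _ "{1..d}"]) (use sh assms in auto)
    qed (use card_shattered_lifted_le[OF p] in auto)
    then show "maximum_class n d (lifted p)"
      using lifted_subset[OF p] card_lifted[OF p] by (simp add: maximum_class_def)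
  qed
  then have sub: "lifted ` (avoiding \<rightarrow>\<^sub>E {1..k})
      \<subseteq> {\<F>. maximum_class n d \<F> \<and> intersection_closed \<F>}" by blast
  have fin': "finite {\<F>. maximum_class n d \<F> \<and> intersection_closed \<F>}"
    by (rule finite_subset[OF _ finite_families[of n "\<lambda>_. True"]]) (auto simp: maximum_class_def)
  have "card avoiding = (n - k) choose d"
    unfolding avoiding_def using assms by (subst n_subsets) (auto simp: card_Diff_subset)
  moreover have "finite avoiding"
    by (rule finite_subset[of _ "Pow {1..n}"]) (auto simp only: avoiding_def finite_Pow_iff finite_atLeastAtMost)
  ultimately have "k ^ ((n - k) choose d) = card (avoiding \<rightarrow>\<^sub>E {1..k})"
    by (simp add: card_PiE)
  also have "\<dots> = card (lifted ` (avoiding \<rightarrow>\<^sub>E {1..k}))"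
    by (rule card_image[OF inj_on_lifted, symmetric])
  also have "\<dots> \<le> num_intersection_closed_maximum_classes n d"
    unfolding num_intersection_closed_maximum_classes_def using fin' sub by (rule card_mono)
  finally show ?thesis .
qed

section \<open>Asymptotics\<close>

lemma binomial_over_power_tendsto:
  "(\<lambda>n. real (n choose d) / real n ^ d) \<longlonglongrightarrow> 1 / fact d"
proof -
  have "(\<lambda>n. (\<Prod>i<d. (real n - real i) / real n) / fact d) \<longlonglongrightarrow> (\<Prod>i<d. 1) / fact d"
    by (intro tendsto_intros) (real_asymp | simp)+
  moreover have "(\<Prod>i<d. (real n - real i) / real n) / fact d = real (n choose d) / real n ^ d" for n
    by (simp add: binomial_gbinomial gbinomial_prod_rev prod_dividef atLeast0LessThan)
  ultimately show ?thesis by simp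
qed

lemma binomial_ratio_tendsto:
  assumes "(\<lambda>n. real (f n) / real n) \<longlonglongrightarrow> 1"
  shows "(\<lambda>n. real (f n choose d) / real (n choose d)) \<longlonglongrightarrow> 1"
proof -
  have "filterlim (\<lambda>n. real (f n) / real n * real n) at_top sequentially"
    by (rule filterlim_tendsto_pos_mult_at_top[OF assms _ filterlim_real_sequentially]) simp
  moreover have "\<forall>\<^sub>F n in sequentially. real (f n) / real n * real n = real (f n)"
    using eventually_gt_at_top[of 0] by eventually_elim simp
  ultimately have "filterlim (\<lambda>n. real (f n)) at_top sequentially"
    by (simp cong: filterlim_cong)
  then have f: "filterlim f at_top sequentially"
    by (simp add: filterlim_sequentially_iff_filterlim_real)
  have "(\<lambda>n. (real (f n choose d) / real (f n) ^ d) * (real (f n) / real n) ^ d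
            / (real (n choose d) / real n ^ d)) \<longlonglongrightarrow> (1 / fact d) * 1 ^ d / (1 / fact d)"
    by (intro tendsto_intros binomial_over_power_tendsto assms
        filterlim_compose[OF binomial_over_power_tendsto f]) simp
  moreover have "\<forall>\<^sub>F n in sequentially. (real (f n choose d) / real (f n) ^ d) * (real (f n) / real n) ^ d
            / (real (n choose d) / real n ^ d) = real (f n choose d) / real (n choose d)"
    using eventually_gt_at_top[of 0] eventually_compose_filterlim[OF eventually_gt_at_top[of 0] f]
    by eventually_elim (simp add: power_divide)
  ultimately show ?thesis by (simp cong: filterlim_cong)
qed

lemma sum_binomial_ratio_tendsto:
  "(\<lambda>n. real (\<Sum>i=0..d. n choose i) / real (n choose d)) \<longlonglongrightarrow> 1"
proof -
  have small: "(\<lambda>n. real (n choose i) / real (n choose d)) \<longlonglongrightarrow> 0" if "i < d" for i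
  proof -
    have "(\<lambda>n. 1 / real n) \<longlonglongrightarrow> 0" by real_asymp
    then have lim0: "(\<lambda>n. (1 / real n) ^ (d - i)) \<longlonglongrightarrow> 0" using that by simp
    have "(\<lambda>n. (real (n choose i) / real n ^ i) * (1 / real n) ^ (d - i)
            / (real (n choose d) / real n ^ d)) \<longlonglongrightarrow> (1 / fact i) * 0 / (1 / fact d)"
      by (intro tendsto_intros binomial_over_power_tendsto lim0) simp
    moreover have "\<forall>\<^sub>F n in sequentially. (real (n choose i) / real n ^ i) * (1 / real n) ^ (d - i)
            / (real (n choose d) / real n ^ d) = real (n choose i) / real (n choose d)"
      using eventually_gt_at_top[of 0]
    proof eventually_elim
      case (elim n)
      have "real n ^ d = real n ^ i * real n ^ (d - i)"
        using that by (simp flip: power_add)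
      then show ?case using elim by (simp add: power_divide)
    qed
    ultimately show ?thesis by (simp cong: filterlim_cong)
  qed
  have "(\<lambda>n. (\<Sum>i<d. real (n choose i) / real (n choose d)) + real (n choose d) / real (n choose d))
      \<longlonglongrightarrow> (\<Sum>i<d. 0) + 1"
    by (intro tendsto_add tendsto_sum small binomial_ratio_tendsto) (simp, real_asymp)
  moreover have "(\<Sum>i<d. real (n choose i) / real (n choose d)) + real (n choose d) / real (n choose d)
      = real (\<Sum>i=0..d. n choose i) / real (n choose d)" for n
    by (simp only: atLeast0AtMost lessThan_Suc_atMost[symmetric] sum.lessThan_Suc of_nat_add
        of_nat_sum add_divide_distrib sum_divide_distrib)
  ultimately show ?thesis by simp
qed

lemma powr_form_of_log_ratio:
  fixes N :: "nat \<Rightarrow> nat"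
  assumes pos: "\<forall>\<^sub>F n in sequentially. N n > 0"
    and lim: "(\<lambda>n. ln (real (N n)) / (real (n choose d) * ln (real n))) \<longlonglongrightarrow> 1"
  shows "\<exists>\<epsilon> :: nat \<Rightarrow> real. \<epsilon> \<in> o(\<lambda>_. 1) \<and>
           (\<forall>\<^sub>F n in sequentially. real (N n) = real n powr (real (n choose d) * (1 - \<epsilon> n)))"
proof (intro exI conjI)
  define \<epsilon> where "\<epsilon> = (\<lambda>n. 1 - ln (real (N n)) / (real (n choose d) * ln (real n)))"
  have "\<epsilon> \<longlonglongrightarrow> 1 - 1" unfolding \<epsilon>_def by (intro tendsto_intros lim)
  then show "\<epsilon> \<in> o(\<lambda>_. 1)" by (intro smalloI_tendsto) auto
  show "\<forall>\<^sub>F n in sequentially. real (N n) = real n powr (real (n choose d) * (1 - \<epsilon> n))"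
    using pos eventually_gt_at_top[of 1] eventually_ge_at_top[of d]
  proof eventually_elim
    case (elim n)
    then have "ln (real n) > 0" "real (n choose d) > 0" by auto
    then have "real (n choose d) * (1 - \<epsilon> n) * ln (real n) = ln (real (N n))"
      by (simp add: \<epsilon>_def)
    then show ?case using elim by (simp add: powr_def)
  qed
qed

text \<open>
  Stated for any counting function between the two numbers of classes, so that it applies to both.
\<close>

lemma log_ratio_tendsto:
  fixes N :: "nat \<Rightarrow> nat"
  assumes d: "d \<ge> 1"
    and lower: "\<And>n. num_intersection_closed_maximum_classes n d \<le> N n"
    and upper: "\<And>n. N n \<le> num_maximum_classes n d"
  shows "(\<forall>\<^sub>F n in sequentially. N n > 0) \<and>
         (\<lambda>n. ln (real (N n)) / (real (n choose d) * ln (real n))) \<longlonglongrightarrow> 1"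
proof
  \<comment> \<open>The number of labels: \<open>o(n)\<close>, but with logarithm asymptotic to \<open>ln n\<close>.\<close>
  define k where "k n = nat \<lceil>real n / ln (real n)\<rceil>" for n
  define M where "M n = (\<Sum>i=0..d. n choose i)" for n
  have k1: "\<forall>\<^sub>F n in sequentially. 1 \<le> k n"
    unfolding k_def by real_asymp
  have k2: "\<forall>\<^sub>F n in sequentially. k n \<le> n"
    unfolding k_def by real_asymp
  have kd: "(\<lambda>n. real (n - k n) / real n) \<longlonglongrightarrow> 1"
  proof -
    have "(\<lambda>n. (real n - real (k n)) / real n) \<longlonglongrightarrow> 1"
      unfolding k_def by real_asymp
    moreover have "\<forall>\<^sub>F n in sequentially. (real n - real (k n)) / real n = real (n - k n) / real n"
      using k2 by eventually_elim simp
    ultimately show ?thesis by (simp cong: filterlim_cong)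
  qed
  have kln: "(\<lambda>n. ln (real (k n)) / ln (real n)) \<longlonglongrightarrow> 1"
    unfolding k_def by real_asymp
  have N_ge: "\<forall>\<^sub>F n in sequentially. k n ^ ((n - k n) choose d) \<le> N n"
    using k1 k2 eventually_ge_at_top[of d]
    by eventually_elim (use lower num_intersection_closed_maximum_classes_ge d le_trans in blast)
  show pos: "\<forall>\<^sub>F n in sequentially. N n > 0"
    using k1 N_ge by eventually_elim (metis less_le_trans less_numeral_extra(1) zero_less_power)
  show "(\<lambda>n. ln (real (N n)) / (real (n choose d) * ln (real n))) \<longlonglongrightarrow> 1"
  proof (rule tendsto_sandwich)
    have "(\<lambda>n. real ((n - k n) choose d) / real (n choose d) * (ln (real (k n)) / ln (real n)))
        \<longlonglongrightarrow> 1 * 1"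
      by (intro tendsto_mult binomial_ratio_tendsto kd kln)
    then show "(\<lambda>n. real ((n - k n) choose d) / real (n choose d) * (ln (real (k n)) / ln (real n)))
        \<longlonglongrightarrow> 1" by simp
    show "\<forall>\<^sub>F n in sequentially.
        real ((n - k n) choose d) / real (n choose d) * (ln (real (k n)) / ln (real n))
        \<le> ln (real (N n)) / (real (n choose d) * ln (real n))"
      using k1 N_ge pos eventually_gt_at_top[of 1]
    proof eventually_elim
      case (elim n)
      have "real (k n) ^ ((n - k n) choose d) \<le> real (N n)"
        using elim(2) by (metis of_nat_le_iff of_nat_power)
      then have "ln (real (k n) ^ ((n - k n) choose d)) \<le> ln (real (N n))"
        using elim by (subst ln_le_cancel_iff) auto
      then have "real ((n - k n) choose d) * ln (real (k n)) \<le> ln (real (N n))"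
        using elim by (simp add: ln_realpow)
      then show ?case using elim by (simp add: divide_right_mono)
    qed
    have "(\<lambda>n. real (M n) / real (n choose d) * (3 * ln 2 / ln (real n) + 1)) \<longlonglongrightarrow> 1 * 1"
      unfolding M_def
      by (intro tendsto_mult sum_binomial_ratio_tendsto) real_asymp
    then show "(\<lambda>n. real (M n) / real (n choose d) * (3 * ln 2 / ln (real n) + 1)) \<longlonglongrightarrow> 1"
      by simp
    show "\<forall>\<^sub>F n in sequentially. ln (real (N n)) / (real (n choose d) * ln (real n))
        \<le> real (M n) / real (n choose d) * (3 * ln 2 / ln (real n) + 1)"
      using pos eventually_gt_at_top[of 1]
    proof eventually_elim
      case (elim n)
      \<comment> \<open>Since \<open>n \<le> M n\<close>, the factor \<open>2 ^ n\<close> for the starting vertex is of lower order even for \<open>d = 1\<close>.\<close>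
      have "n choose 1 \<le> M n" unfolding M_def using d by (intro member_le_sum) auto
      then have nM: "n \<le> M n" by simp
      have "1 \<le> n" using elim by simp
      have "N n \<le> 2 ^ n * (2 ^ (2 * M n) * n ^ M n)"
        unfolding M_def using num_maximum_classes_le[OF \<open>1 \<le> n\<close>, of d] upper[of n]
        by (rule order_trans[rotated])
      also have "\<dots> \<le> 2 ^ M n * (2 ^ (2 * M n) * n ^ M n)"
        using nM by (intro mult_le_mono1 power_increasing) auto
      also have "\<dots> = 2 ^ (3 * M n) * n ^ M n" by (simp flip: power_add mult.assoc)
      finally have "real (N n) \<le> 2 ^ (3 * M n) * real n ^ M n"
        by (metis (mono_tags, lifting) of_nat_le_iff of_nat_mult of_nat_numeral of_nat_power)
      then have "ln (real (N n)) \<le> ln (2 ^ (3 * M n) * real n ^ M n)"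
        using elim by (subst ln_le_cancel_iff) auto
      also have "\<dots> = real (M n) * (3 * ln 2 + ln (real n))"
        using elim by (simp add: ln_mult ln_realpow algebra_simps)
      finally have "ln (real (N n)) / (real (n choose d) * ln (real n))
          \<le> real (M n) * (3 * ln 2 + ln (real n)) / (real (n choose d) * ln (real n))"
        using elim by (intro divide_right_mono) auto
      also have "\<dots> = real (M n) / real (n choose d) * (3 * ln 2 / ln (real n) + 1)"
        using elim by (simp add: divide_simps)
      finally show ?case .
    qed
  qed
qed

lemma num_intersection_closed_le_num_maximum:
  "num_intersection_closed_maximum_classes n d \<le> num_maximum_classes n d"
  unfolding num_intersection_closed_maximum_classes_def num_maximum_classes_def
proof (rule card_mono)
  show "finite {\<F>. maximum_class n d \<F>}"
    by (rule finite_subset[OF _ finite_families[of n "\<lambda>_. True"]]) (auto simp: maximum_class_def)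
qed blast

theorem theorem6p3:
  fixes d :: nat
  assumes "d \<ge> 1"
  shows "(\<exists>\<epsilon> :: nat \<Rightarrow> real. \<epsilon> \<in> o(\<lambda>_. 1) \<and>
           (\<forall>\<^sub>F n in sequentially.
              real (num_maximum_classes n d) =
                real n powr (real (n choose d) * (1 - \<epsilon> n))))
       \<and> (\<exists>\<epsilon> :: nat \<Rightarrow> real. \<epsilon> \<in> o(\<lambda>_. 1) \<and>
           (\<forall>\<^sub>F n in sequentially.
              real (num_intersection_closed_maximum_classes n d) =
                real n powr (real (n choose d) * (1 - \<epsilon> n))))"
  using log_ratio_tendsto[OF assms, of "\<lambda>n. num_maximum_classes n d"]
    log_ratio_tendsto[OF assms, of "\<lambda>n. num_intersection_closed_maximum_classes n d"]
  by (intro conjI powr_form_of_log_ratio) (simp_all add: num_intersection_closed_le_num_maximum)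

end
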